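(* Let $t\ge 3$ be an integer and let $\mathcal{H}$ be a family of graphs edge-colored from $[t]$ such that for each $H\in\mathcal{H}$ and each edge $uv\in E(H)$ there is a rainbow path with exactly $2$ edges connecting $u$ to $v$ in $H$ (i.e. a vertex $w$ of $H$ with $uw,wv\in E(H)$ receiving distinct colors). Then $$\left(\frac13-o(1)\right)\frac{n\log n}{\log t}\le \mathrm{sat}_t(n,\mathcal{H}),$$ where the $o(1)$ term tends to $0$ as $n\to\infty$ with $t$ fixed.
   Context: All graphs are finite and simple. Write $[t]=\{1,\dots,t\}$. A $t$-edge-coloring of a graph $G$ is an arbitrary function $E(G)\to[t]$ (not necessarily proper). Given a family $\mathcal{C}$ of graphs edge-colored from $[t]$, a $t$-edge-colored graph $G$ is $(\mathcal{C},t)$-saturated if $G$ contains no member of $\mathcal{C}$ as a colored subgraph (not necessarily induced, colors matching), but for every non-edge $e\in E(\overline{G})$ and every color $i\in[t]$, adding $e$ to $G$ in color $i$ creates a colored subgraph that is a member of $\mathcal{C}$. The number $\mathrm{sat}_t(n,\mathcal{C})$ is the minimum number of edges in a $(\mathcal{C},t)$-saturated graph on $n$ vertices (interpreted as $+\infty$ in the degenerate case that no such graph exists). An edge-colored graph is rainbow if its edges have pairwise distinct colors. *)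

theory Defs
  imports Complex_Main "HOL-Library.Extended_Real"
begin

text \<open>
  Finite simple graphs with edges as two-element vertex sets. The colouring is a total function;
  only its values on edges are meaningful.
\<close>

record 'a cgraph =
  verts :: "'a set"
  edges :: "'a set set"
  col :: "'a set \<Rightarrow> nat"

definition vertex_pairs :: "'a set \<Rightarrow> 'a set set" where
  "vertex_pairs V = {e. e \<subseteq> V \<and> card e = 2}"

definition edge_colored_graph :: "nat \<Rightarrow> 'a cgraph \<Rightarrow> bool" where
  "edge_colored_graph t G \<longleftrightarrow>
     finite (verts G) \<and> edges G \<subseteq> vertex_pairs (verts G) \<and> col G ` edges G \<subseteq> {1..t}"

text \<open>\<open>G\<close> has a (not necessarily induced) subgraph isomorphic, colours included, to \<open>H\<close>.\<close>

definition contains_colored :: "'a cgraph \<Rightarrow> 'b cgraph \<Rightarrow> bool" where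
  "contains_colored G H \<longleftrightarrow>
     (\<exists>f. inj_on f (verts H) \<and> f ` verts H \<subseteq> verts G \<and>
          (\<forall>e\<in>edges H. f ` e \<in> edges G \<and> col G (f ` e) = col H e))"

definition add_edge :: "'a cgraph \<Rightarrow> 'a set \<Rightarrow> nat \<Rightarrow> 'a cgraph" where
  "add_edge G e i = G\<lparr>edges := insert e (edges G), col := (col G)(e := i)\<rparr>"

definition saturated :: "'b cgraph set \<Rightarrow> nat \<Rightarrow> 'a cgraph \<Rightarrow> bool" where
  "saturated \<C> t G \<longleftrightarrow>
     edge_colored_graph t G \<and>
     \<not> (\<exists>H\<in>\<C>. contains_colored G H) \<and>
     (\<forall>e\<in>vertex_pairs (verts G) - edges G. \<forall>i\<in>{1..t}.
        \<exists>H\<in>\<C>. contains_colored (add_edge G e i) H)"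

text \<open>
  Every finite graph has an isomorphic copy on natural numbers, so fixing the vertex type of the
  host graph loses nothing. The infimum of a nonempty set in \<^typ>\<open>enat\<close> is its minimum, that of
  the empty set is \<open>\<infinity>\<close>.
\<close>

definition sat :: "nat \<Rightarrow> nat \<Rightarrow> 'b cgraph set \<Rightarrow> enat" where
  "sat t n \<C> =
     (INF G\<in>{G :: nat cgraph. saturated \<C> t G \<and> card (verts G) = n}. enat (card (edges G)))"

fun path_edges :: "'a list \<Rightarrow> 'a set list" where
  "path_edges (x # y # xs) = {x, y} # path_edges (y # xs)"
| "path_edges _ = []"

definition rainbow_path :: "'a cgraph \<Rightarrow> 'a \<Rightarrow> 'a list \<Rightarrow> 'a \<Rightarrow> bool" where
  "rainbow_path G u p v \<longleftrightarrow>
     p \<noteq> [] \<and> hd p = u \<and> last p = v \<and> distinct p \<and> set p \<subseteq> verts G \<and>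
     set (path_edges p) \<subseteq> edges G \<and> distinct (map (col G) (path_edges p))"

end

theory Submission
  imports Defs "HOL-Library.FuncSet" "HOL-Real_Asymp.Real_Asymp"
begin

text \<open>
  Let \<open>G\<close> be saturated and let \<open>u\<close>, \<open>v\<close> be non-adjacent. Adding \<open>uv\<close> creates a forbidden graph that uses
  the new edge, and the rainbow path of length two joining its ends consists of old edges. So \<open>u\<close> and
  \<open>v\<close> have a common neighbour \<open>w\<close> with \<open>uw\<close> and \<open>vw\<close> of different colours
  (\<open>saturated_imp_rainbow_common_nbrs\<close>). This property already forces many edges.

  Give every vertex \<open>w\<close> an independent uniformly random colour \<open>f w\<close>, and let a vertex \<open>v\<close> survive if
  every edge \<open>vw\<close> has the colour \<open>f w\<close>. A vertex of degree \<open>d\<close> survives with probability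
  \<open>t\<^sup>-\<^sup>d\<close>. Two survivors cannot have a common neighbour to which they send different colours, so
  they are adjacent: the survivors always form a clique. Among the vertices of degree at most \<open>m\<close> a
  clique has at most \<open>m + 1\<close> elements, and comparing with the expected number of survivors shows that
  there are at most \<open>(m + 1) t\<^sup>m\<close> such vertices (\<open>card_low_degree_le\<close>).

  For \<open>m\<close> close to \<open>a log n / log t\<close> with \<open>a < 1\<close> this is \<open>o(n)\<close>, so almost all vertices have degree
  more than \<open>a log n / log t\<close>. Summing degrees gives at least \<open>(a/2 - o(1)) n log n / log t\<close> edges
  (\<open>eventually_edges_ge\<close>). Hence every constant below \<open>1/2\<close>, in particular \<open>1/3\<close>, is reached for all
  large \<open>n\<close>, with a threshold that depends on \<open>t\<close> alone.
\<close>

section \<open>Partial labellings that separate most pairs\<close>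

text \<open>
  The first-moment argument, in the form of a double count over all total labellings
  \<open>f : W \<rightarrow> C\<close>. A fraction \<open>1 / \<bar>C\<bar>\<^sup>d\<close> of them extends a given partial labelling with \<open>d\<close> labels,
  whereas the partial labellings extended by one and the same \<open>f\<close> are pairwise consistent, so that
  there are at most \<open>k\<close> of them.
\<close>

lemma sum_inverse_powers_partial_labels_le:
  fixes N :: "'v \<Rightarrow> 'w set" and c :: "'v \<Rightarrow> 'w \<Rightarrow> 'c" and k :: nat
  assumes fin: "finite S" "finite W" "finite C" and "C \<noteq> {}"
    and N: "\<And>v. v \<in> S \<Longrightarrow> N v \<subseteq> W"
    and c: "\<And>v w. v \<in> S \<Longrightarrow> w \<in> N v \<Longrightarrow> c v w \<in> C"
    and consistent: "\<And>T. T \<subseteq> S \<Longrightarrow>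
      (\<And>u v w. u \<in> T \<Longrightarrow> v \<in> T \<Longrightarrow> w \<in> N u \<Longrightarrow> w \<in> N v \<Longrightarrow> c u w = c v w) \<Longrightarrow> card T \<le> k"
  shows "(\<Sum>v\<in>S. 1 / real (card C) ^ card (N v)) \<le> real k"
proof -
  define F where "F = W \<rightarrow>\<^sub>E C"
  define agrees where "agrees f v \<longleftrightarrow> (\<forall>w\<in>N v. f w = c v w)" for f v
  have q: "card C > 0" using assms by (simp add: card_gt_0_iff)
  have finF: "finite F" unfolding F_def using fin by (intro finite_PiE) auto
  have cardF: "card F = card C ^ card W" unfolding F_def using fin by (simp add: card_PiE)
  have agreeing: "real (card {f \<in> F. agrees f v}) = real (card F) * (1 / real (card C) ^ card (N v))"
    if "v \<in> S" for v
  proof -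
    have "{f \<in> F. agrees f v} = (\<Pi>\<^sub>E w\<in>W. if w \<in> N v then {c v w} else C)"
    proof (intro equalityI subsetI)
      fix f assume "f \<in> {f \<in> F. agrees f v}"
      then show "f \<in> (\<Pi>\<^sub>E w\<in>W. if w \<in> N v then {c v w} else C)"
        unfolding F_def agrees_def PiE_iff by auto
    next
      fix f assume f: "f \<in> (\<Pi>\<^sub>E w\<in>W. if w \<in> N v then {c v w} else C)"
      have val: "f w \<in> (if w \<in> N v then {c v w} else C)" if "w \<in> W" for w
        using f that by (rule PiE_mem)
      have "f \<in> extensional W" using f by (simp add: PiE_iff)
      moreover have "f w \<in> C" if "w \<in> W" for w
        using val[OF that] c[OF \<open>v \<in> S\<close>] by (auto split: if_splits)
      moreover have "f w = c v w" if "w \<in> N v" for w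
        using val[of w] N[OF \<open>v \<in> S\<close>] that by auto
      ultimately show "f \<in> {f \<in> F. agrees f v}"
        unfolding F_def agrees_def by (auto simp: PiE_iff)
    qed
    then have "card {f \<in> F. agrees f v} = (\<Prod>w\<in>W. if w \<in> N v then 1 else card C)"
      using fin by (simp add: card_PiE if_distrib[of card] cong: if_cong)
    also have "\<dots> = card C ^ card (W - N v)"
      using fin by (simp add: prod.If_cases Diff_eq)
    finally have "card {f \<in> F. agrees f v} = card C ^ card (W - N v)" .
    moreover have "card W = card (W - N v) + card (N v)"
      using N[OF that] fin by (metis card_Diff_subset card_mono finite_subset le_add_diff_inverse2)
    ultimately show ?thesis using q by (simp add: cardF power_add)
  qed
  have "real (card F) * (\<Sum>v\<in>S. 1 / real (card C) ^ card (N v))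
      = (\<Sum>v\<in>S. real (card {f \<in> F. agrees f v}))"
    by (simp only: sum_distrib_left agreeing cong: sum.cong)
  also have "\<dots> = (\<Sum>f\<in>F. real (card {v \<in> S. agrees f v}))"
    using sum.swap_restrict[OF fin(1) finF, of "\<lambda>_ _. 1 :: real" "\<lambda>v f. agrees f v"] by simp
  also have "\<dots> \<le> (\<Sum>f\<in>F. real k)"
  proof (intro sum_mono of_nat_mono consistent)
    fix f u v w
    assume "u \<in> {v \<in> S. agrees f v}" "v \<in> {v \<in> S. agrees f v}" "w \<in> N u" "w \<in> N v"
    then show "c u w = c v w" unfolding agrees_def by (metis (mono_tags, lifting) mem_Collect_eq)
  qed auto
  finally have "real (card F) * (\<Sum>v\<in>S. 1 / real (card C) ^ card (N v)) \<le> real (card F) * real k"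
    by simp
  moreover have "real (card F) > 0" using q by (simp add: cardF)
  ultimately show ?thesis by simp
qed

section \<open>Neighbourhoods in edge-coloured graphs\<close>

definition nbrs :: "'a cgraph \<Rightarrow> 'a \<Rightarrow> 'a set" where
  "nbrs G v = {w. {v, w} \<in> edges G}"

lemma edge_colored_graph_edgeD:
  assumes "edge_colored_graph t G" "{u, v} \<in> edges G"
  shows "u \<in> verts G" "v \<in> verts G" "u \<noteq> v" "col G {u, v} \<in> {1..t}"
  using assms unfolding edge_colored_graph_def vertex_pairs_def by (auto simp: card_2_iff)

lemma nbrs_subset_verts:
  assumes "edge_colored_graph t G"
  shows "nbrs G v \<subseteq> verts G"
  using edge_colored_graph_edgeD[OF assms] unfolding nbrs_def by auto

lemma finite_nbrs:
  assumes "edge_colored_graph t G"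
  shows "finite (nbrs G v)"
  using nbrs_subset_verts[OF assms] assms unfolding edge_colored_graph_def by (metis finite_subset)

lemma sum_degrees_eq:
  assumes G: "edge_colored_graph t G"
  shows "(\<Sum>v\<in>verts G. card (nbrs G v)) = 2 * card (edges G)"
proof -
  have finV: "finite (verts G)" and E: "edges G \<subseteq> vertex_pairs (verts G)"
    using G unfolding edge_colored_graph_def by auto
  have finE: "finite (edges G)"
    by (rule finite_subset[OF E]) (simp add: vertex_pairs_def finV)
  have "card (nbrs G v) = card {e \<in> edges G. v \<in> e}" for v
  proof -
    have "inj_on (\<lambda>w. {v, w}) (nbrs G v)" by (auto simp: inj_on_def doubleton_eq_iff)
    moreover have "(\<lambda>w. {v, w}) ` nbrs G v = {e \<in> edges G. v \<in> e}"
    proof (intro equalityI subsetI)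
      fix e assume e: "e \<in> {e \<in> edges G. v \<in> e}"
      then have "card e = 2" using E unfolding vertex_pairs_def by auto
      then obtain w where "e = {v, w}" using e by (auto simp: card_2_iff)
      then show "e \<in> (\<lambda>w. {v, w}) ` nbrs G v" using e unfolding nbrs_def by auto
    qed (auto simp: nbrs_def)
    ultimately show ?thesis by (metis card_image)
  qed
  then have "(\<Sum>v\<in>verts G. card (nbrs G v)) = (\<Sum>v\<in>verts G. card {e \<in> edges G. v \<in> e})"
    by simp
  also have "\<dots> = 2 * card (edges G)"
  proof (rule sum_multicount[OF finV finE], intro ballI)
    fix e assume "e \<in> edges G"
    then have "{v \<in> verts G. v \<in> e} = e" "card e = 2" using E unfolding vertex_pairs_def by auto
    then show "card {v \<in> verts G. v \<in> e} = 2" by simp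
  qed
  finally show ?thesis .
qed

lemma path_edges_length_two:
  assumes "length (path_edges p) = 2"
  obtains a b c where "p = [a, b, c]"
  using assms that
  by (cases p; cases "tl p"; cases "tl (tl p)"; cases "tl (tl (tl p))") auto

section \<open>Edges forced by differently coloured paths of length two\<close>

definition rainbow_common_nbrs :: "'a cgraph \<Rightarrow> bool" where
  "rainbow_common_nbrs G \<longleftrightarrow>
     (\<forall>u\<in>verts G. \<forall>v\<in>verts G. u \<noteq> v \<longrightarrow> {u, v} \<notin> edges G \<longrightarrow>
        (\<exists>w. {u, w} \<in> edges G \<and> {v, w} \<in> edges G \<and> col G {u, w} \<noteq> col G {v, w}))"

text \<open>
  A forbidden graph that appears when \<open>uv\<close> is added must use \<open>uv\<close>, since \<open>G\<close> contains none. The image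
  of the rainbow path avoids the new edge because its middle vertex differs from \<open>u\<close> and \<open>v\<close>; hence
  the path is present in \<open>G\<close> with its original colours.
\<close>

lemma saturated_imp_rainbow_common_nbrs:
  assumes "t \<ge> 1" and sat: "saturated \<H> t G"
    and paths: "\<And>H u v. H \<in> \<H> \<Longrightarrow> {u, v} \<in> edges H \<Longrightarrow>
      \<exists>p. rainbow_path H u p v \<and> length (path_edges p) = 2"
    and wf: "\<And>H. H \<in> \<H> \<Longrightarrow> edge_colored_graph t H"
  shows "rainbow_common_nbrs G"
  unfolding rainbow_common_nbrs_def
proof (intro ballI impI)
  fix u v assume uv: "u \<in> verts G" "v \<in> verts G" "u \<noteq> v" "{u, v} \<notin> edges G"
  then have "{u, v} \<in> vertex_pairs (verts G) - edges G" by (simp add: vertex_pairs_def)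
  with sat \<open>t \<ge> 1\<close> obtain H where H: "H \<in> \<H>" "contains_colored (add_edge G {u, v} 1) H"
    unfolding saturated_def by (metis atLeastAtMost_iff order_refl)
  then obtain f where f: "inj_on f (verts H)" "f ` verts H \<subseteq> verts G"
      "\<And>e. e \<in> edges H \<Longrightarrow> f ` e \<in> insert {u, v} (edges G)"
      "\<And>e. e \<in> edges H \<Longrightarrow> ((col G)({u, v} := 1)) (f ` e) = col H e"
    unfolding contains_colored_def add_edge_def by auto
  have old: "f ` e \<in> edges G \<and> col G (f ` e) = col H e" if "e \<in> edges H" "f ` e \<noteq> {u, v}" for e
    using f(3,4)[OF that(1)] that(2) by auto
  have "\<exists>e\<in>edges H. f ` e = {u, v}"
  proof (rule ccontr)
    assume "\<not> (\<exists>e\<in>edges H. f ` e = {u, v})"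
    then have "contains_colored G H" unfolding contains_colored_def using f(1,2) old by blast
    then show False using sat H(1) unfolding saturated_def by blast
  qed
  then obtain e where e: "e \<in> edges H" "f ` e = {u, v}" by blast
  have "e \<subseteq> verts H" "card e = 2"
    using wf[OF H(1)] e(1) unfolding edge_colored_graph_def vertex_pairs_def by auto
  then obtain y z where "e = {y, z}" by (auto simp: card_2_iff)
  with e(2) have "e = {y, z} \<and> f y = u \<and> f z = v \<or> e = {z, y} \<and> f z = u \<and> f y = v"
    by (auto simp: doubleton_eq_iff)
  then obtain a b where ab: "e = {a, b}" "f a = u" "f b = v" by blast
  obtain p where p: "rainbow_path H a p b" "length (path_edges p) = 2"
    using paths[OF H(1)] e(1) ab(1) by blast
  obtain x where x: "p = [a, x, b]"
    using p unfolding rainbow_path_def by (auto elim!: path_edges_length_two)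
  have x': "x \<in> verts H" "a \<in> verts H" "b \<in> verts H" "x \<noteq> a" "x \<noteq> b"
      "{a, x} \<in> edges H" "{x, b} \<in> edges H" "col H {a, x} \<noteq> col H {x, b}"
    using p(1) unfolding rainbow_path_def x by auto
  have "f x \<noteq> u" "f x \<noteq> v" using f(1) x' ab by (auto dest: inj_onD)
  then have "f ` {a, x} \<noteq> {u, v}" "f ` {x, b} \<noteq> {u, v}" using ab by (auto simp: doubleton_eq_iff)
  from old[OF x'(6) this(1)] old[OF x'(7) this(2)]
  show "\<exists>w. {u, w} \<in> edges G \<and> {v, w} \<in> edges G \<and> col G {u, w} \<noteq> col G {v, w}"
    using x'(8) ab by (intro exI[of _ "f x"]) (auto simp: insert_commute)
qed

text \<open>
  View the colours at \<open>v\<close> as a partial labelling of the vertices, defined on the neighbourhood of \<open>v\<close>.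
  Consistent labellings belong to adjacent vertices, and a clique through a vertex of degree at most
  \<open>m\<close> lies in the closed neighbourhood of that vertex.
\<close>

lemma card_low_degree_le:
  assumes G: "edge_colored_graph t G" and "t \<ge> 1" and rb: "rainbow_common_nbrs G"
  shows "card {v \<in> verts G. card (nbrs G v) \<le> m} \<le> (m + 1) * t ^ m"
proof -
  define S where "S = {v \<in> verts G. card (nbrs G v) \<le> m}"
  have finV: "finite (verts G)" using G unfolding edge_colored_graph_def by blast
  have "(\<Sum>v\<in>S. 1 / real (card {1..t}) ^ card (nbrs G v)) \<le> real (m + 1)"
  proof (rule sum_inverse_powers_partial_labels_le[where W = "verts G" and c = "\<lambda>v w. col G {v, w}"])
    fix T assume T: "T \<subseteq> S"
      and same: "\<And>u v w. u \<in> T \<Longrightarrow> v \<in> T \<Longrightarrow> w \<in> nbrs G u \<Longrightarrow> w \<in> nbrs G v \<Longrightarrow>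
        col G {u, w} = col G {v, w}"
    show "card T \<le> m + 1"
    proof (cases "T = {}")
      case False
      then obtain v where v: "v \<in> T" by blast
      have "T \<subseteq> insert v (nbrs G v)"
      proof
        fix u assume u: "u \<in> T"
        then show "u \<in> insert v (nbrs G v)"
          using rb T v same[OF v u] unfolding rainbow_common_nbrs_def S_def nbrs_def by fastforce
      qed
      then have "card T \<le> card (insert v (nbrs G v))"
        by (intro card_mono) (simp_all add: finite_nbrs[OF G])
      also have "\<dots> \<le> card (nbrs G v) + 1" by (simp add: card_insert_if finite_nbrs[OF G])
      also have "\<dots> \<le> m + 1" using v T unfolding S_def by auto
      finally show ?thesis .
    qed simp
  qed (use G finV \<open>t \<ge> 1\<close> nbrs_subset_verts[OF G] edge_colored_graph_edgeD(4)[OF G]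
       in \<open>auto simp: S_def nbrs_def\<close>)
  moreover have "real (card S) * (1 / real t ^ m) \<le> (\<Sum>v\<in>S. 1 / real (card {1..t}) ^ card (nbrs G v))"
  proof -
    have "(\<Sum>v\<in>S. 1 / real t ^ m) \<le> (\<Sum>v\<in>S. 1 / real (card {1..t}) ^ card (nbrs G v))"
      using \<open>t \<ge> 1\<close> unfolding S_def
      by (intro sum_mono divide_left_mono) (auto intro: power_increasing)
    then show ?thesis by simp
  qed
  ultimately have "real (card S) * (1 / real t ^ m) \<le> real (m + 1)" by linarith
  then have "real (card S) \<le> real (m + 1) * real t ^ m"
    using \<open>t \<ge> 1\<close> by (simp add: field_simps)
  also have "\<dots> = real ((m + 1) * t ^ m)" by (simp add: algebra_simps)
  finally have "real (card S) \<le> real ((m + 1) * t ^ m)" .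
  then show ?thesis unfolding S_def by (simp only: of_nat_le_iff)
qed

lemma edges_ge_of_rainbow_common_nbrs:
  assumes G: "edge_colored_graph t G" and "t \<ge> 1" and "rainbow_common_nbrs G"
  shows "(real m + 1) * (real (card (verts G)) - (real m + 1) * real t ^ m)
      \<le> 2 * real (card (edges G))"
proof -
  define S where "S = {v \<in> verts G. card (nbrs G v) \<le> m}"
  have finV: "finite (verts G)" using G unfolding edge_colored_graph_def by blast
  have "card S \<le> (m + 1) * t ^ m" unfolding S_def by (rule card_low_degree_le[OF assms])
  then have "real (card S) \<le> real ((m + 1) * t ^ m)" by (simp only: of_nat_le_iff)
  also have "\<dots> = (real m + 1) * real t ^ m" by (simp add: algebra_simps)
  finally have "real (card S) \<le> (real m + 1) * real t ^ m" .
  moreover have "real (card (verts G - S)) = real (card (verts G)) - real (card S)"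
    using finV by (simp add: S_def card_Diff_subset card_mono of_nat_diff)
  ultimately have "real (card (verts G)) - (real m + 1) * real t ^ m \<le> real (card (verts G - S))"
    by linarith
  then have "(real m + 1) * (real (card (verts G)) - (real m + 1) * real t ^ m)
      \<le> (real m + 1) * real (card (verts G - S))"
    by (intro mult_left_mono) auto
  also have "\<dots> = real ((m + 1) * card (verts G - S))" by (simp add: algebra_simps)
  also have "(m + 1) * card (verts G - S) \<le> 2 * card (edges G)"
  proof -
    have "(m + 1) * card (verts G - S) = (\<Sum>v\<in>verts G - S. m + 1)" by simp
    also have "\<dots> \<le> (\<Sum>v\<in>verts G - S. card (nbrs G v))"
      by (intro sum_mono) (auto simp: S_def)
    also have "\<dots> \<le> (\<Sum>v\<in>verts G. card (nbrs G v))"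
      using finV by (intro sum_mono2) auto
    also have "\<dots> = 2 * card (edges G)" by (rule sum_degrees_eq[OF G])
    finally show ?thesis .
  qed
  finally show ?thesis by simp
qed

section \<open>Asymptotics\<close>

text \<open>
  The factor \<open>1 / 2\<close> comes from the handshake identity: almost all degrees are at least
  \<open>a log n / log t\<close> for any fixed \<open>a < 1\<close>.
\<close>

lemma eventually_edges_ge:
  fixes t :: nat and c :: real
  assumes "t \<ge> 2" and "c < 1 / 2"
  shows "\<forall>\<^sub>F n in sequentially. \<forall>G :: 'a cgraph.
    edge_colored_graph t G \<and> rainbow_common_nbrs G \<and> card (verts G) = n \<longrightarrow>
      c * (real n * ln (real n) / ln (real t)) \<le> real (card (edges G))"
proof -
  \<comment> \<open>Replacing a negative \<open>c\<close> by \<open>0\<close> keeps all products below monotone. The exponent \<open>a\<close> only has to lie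
      strictly between \<open>2 * b\<close> and \<open>1\<close>: the first gap absorbs the low-degree vertices, the second makes
      them \<open>o(n)\<close>.\<close>
  define b where "b = max c 0"
  define a where "a = b + 1 / 2"
  have a: "0 < a" "a < 1" "2 * b < a" and b: "0 \<le> b" "c \<le> b"
    using \<open>c < 1 / 2\<close> by (auto simp: a_def b_def)
  define L where "L n = ln (real n) / ln (real t)" for n :: nat
  have lnt: "ln (real t) > 0" using \<open>t \<ge> 2\<close> by simp
  have "((\<lambda>n. (a * (ln (real n) / ln (real t)) + 1) * real n powr a / real n) \<longlongrightarrow> 0) sequentially"
    using a lnt by real_asymp
  moreover have "0 < 1 - 2 * b / a" using a by simp
  ultimately have "\<forall>\<^sub>F n in sequentially.
      (a * L n + 1) * real n powr a / real n < 1 - 2 * b / a"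
    unfolding L_def by (rule order_tendstoD(2))
  then show ?thesis
    using eventually_ge_at_top[of 1]
  proof eventually_elim
    case (elim n)
    have n: "real n > 0" using elim by simp
    have L: "L n \<ge> 0" unfolding L_def using elim lnt by simp
    define m where "m = nat \<lfloor>a * L n\<rfloor>"
    have m: "real m \<le> a * L n" "a * L n \<le> real m + 1"
      unfolding m_def using a L by (simp_all add: of_nat_nat)
    have "real t ^ m = real t powr real m" using \<open>t \<ge> 2\<close> by (simp add: powr_realpow)
    also have "\<dots> \<le> real t powr (a * L n)" using m \<open>t \<ge> 2\<close> by (intro powr_mono) auto
    also have "\<dots> = real n powr a"
      using n lnt \<open>t \<ge> 2\<close> by (simp add: powr_def L_def)
    finally have "(real m + 1) * real t ^ m \<le> (a * L n + 1) * real n powr a"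
      using m a L by (intro mult_mono) auto
    also have "\<dots> \<le> (1 - 2 * b / a) * real n"
      using elim n by (simp add: field_simps)
    finally have "2 * b / a * real n \<le> real n - (real m + 1) * real t ^ m"
      by (simp add: algebra_simps)
    then have "(a * L n) * (2 * b / a * real n)
        \<le> (real m + 1) * (real n - (real m + 1) * real t ^ m)"
      using m a b L n by (intro mult_mono) auto
    then have main: "2 * (b * (real n * L n)) \<le> (real m + 1) * (real n - (real m + 1) * real t ^ m)"
      using a by (simp add: mult_ac)
    show ?case
    proof (intro allI impI, elim conjE)
      fix G :: "'a cgraph"
      assume G: "edge_colored_graph t G" "rainbow_common_nbrs G" "card (verts G) = n"
      have "c * (real n * L n) \<le> b * (real n * L n)" using b L n by (intro mult_right_mono) auto
      moreover have "2 * (b * (real n * L n)) \<le> 2 * real (card (edges G))"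
        using main edges_ge_of_rainbow_common_nbrs[OF G(1) _ G(2), of m] G(3) \<open>t \<ge> 2\<close> by simp
      ultimately have "c * (real n * L n) \<le> real (card (edges G))" by linarith
      then show "c * (real n * ln (real n) / ln (real t)) \<le> real (card (edges G))"
        by (simp add: L_def)
    qed
  qed
qed

lemma le_sat_iff:
  "ereal x \<le> ereal_of_enat (sat t n \<C>) \<longleftrightarrow>
    (\<forall>G :: nat cgraph. saturated \<C> t G \<and> card (verts G) = n \<longrightarrow> x \<le> real (card (edges G)))"
proof -
  define A where "A = (\<lambda>G. enat (card (edges G))) `
    {G :: nat cgraph. saturated \<C> t G \<and> card (verts G) = n}"
  have sat: "sat t n \<C> = Inf A" by (simp add: sat_def A_def)
  show ?thesis
  proof (intro iffI allI impI)
    fix G :: "nat cgraph"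
    assume x: "ereal x \<le> ereal_of_enat (sat t n \<C>)" and G: "saturated \<C> t G \<and> card (verts G) = n"
    have "Inf A \<le> enat (card (edges G))" using G by (intro Inf_lower) (auto simp: A_def)
    then have "ereal x \<le> ereal_of_enat (enat (card (edges G)))"
      using x unfolding sat by (meson ereal_of_enat_le_iff order_trans)
    then show "x \<le> real (card (edges G))" by simp
  next
    assume all: "\<forall>G :: nat cgraph. saturated \<C> t G \<and> card (verts G) = n \<longrightarrow> x \<le> real (card (edges G))"
    show "ereal x \<le> ereal_of_enat (sat t n \<C>)"
    proof (cases "A = {}")
      case True
      then show ?thesis unfolding sat by (simp add: Inf_enat_def)
    next
      case False
      then have "Inf A \<in> A" by (auto simp: Inf_enat_def intro: LeastI)
      then show ?thesis unfolding sat using all by (auto simp: A_def)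
    qed
  qed
qed

theorem theorem5:
  fixes t :: nat
  assumes "t \<ge> 3"
  shows "\<exists>err :: nat \<Rightarrow> real. err \<longlonglongrightarrow> 0 \<and>
    (\<forall>\<H> :: nat cgraph set.
       (\<forall>H\<in>\<H>. edge_colored_graph t H \<and>
          (\<forall>u v. {u, v} \<in> edges H \<longrightarrow>
             (\<exists>p. rainbow_path H u p v \<and> length (path_edges p) = 2))) \<longrightarrow>
       (\<forall>n. ereal ((1 / 3 - err n) * (real n * ln (real n) / ln (real t)))
              \<le> ereal_of_enat (sat t n \<H>)))"
proof -
  obtain n0 where n0: "\<And>n (G :: nat cgraph). n \<ge> n0 \<Longrightarrow> edge_colored_graph t G \<Longrightarrow>
      rainbow_common_nbrs G \<Longrightarrow> card (verts G) = n \<Longrightarrow>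
      1 / 3 * (real n * ln (real n) / ln (real t)) \<le> real (card (edges G))"
    using eventually_edges_ge[of t "1 / 3", where 'a = nat] assms
    unfolding eventually_sequentially by auto
  \<comment> \<open>Below the threshold the error \<open>1 / 3\<close> makes the claimed bound trivial.\<close>
  define err :: "nat \<Rightarrow> real" where "err n = (if n < n0 then 1 / 3 else 0)" for n
  have "err \<longlonglongrightarrow> 0"
    by (rule tendsto_eventually) (auto simp: eventually_sequentially err_def intro: exI[of _ n0])
  moreover have "ereal ((1 / 3 - err n) * (real n * ln (real n) / ln (real t)))
      \<le> ereal_of_enat (sat t n \<H>)"
    if "\<forall>H\<in>\<H>. edge_colored_graph t H \<and>
          (\<forall>u v. {u, v} \<in> edges H \<longrightarrow>
             (\<exists>p. rainbow_path H u p v \<and> length (path_edges p) = 2))"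
    for \<H> :: "nat cgraph set" and n
    unfolding le_sat_iff
  proof (intro allI impI)
    fix G :: "nat cgraph" assume G: "saturated \<H> t G \<and> card (verts G) = n"
    have "rainbow_common_nbrs G"
      by (rule saturated_imp_rainbow_common_nbrs[of t \<H>]) (use G that assms in auto)
    then show "(1 / 3 - err n) * (real n * ln (real n) / ln (real t)) \<le> real (card (edges G))"
      using n0[of n G] G unfolding err_def saturated_def by auto
  qed
  ultimately show ?thesis by blast
qed

end
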